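(* Let $G$ be a finite group with identity element $e$ and let $\mu:G\to\mathbb{Z}_{>0}$ be a function such that $\mu(e)=1$. Then $$\sum_{x\in G}\mu(x)\,\mathrm{occ}_G(x)^2=\sum_{H\leqslant G}\left(\sum_{x\in H}\mu(x)\,\mathrm{occ}_G(x)\right)=\sum_{H\leqslant G}\left(\sum_{L\leqslant G}\left(\sum_{x\in H\cap L}\mu(x)\right)\right).$$
   Context: $H\leqslant G$ means that $H$ is a subgroup of $G$; sums over $H\leqslant G$ or $L\leqslant G$ run over all subgroups of $G$. For $x\in G$, the subgroup-occurrence of $x$ in $G$ is $\mathrm{occ}_G(x):=|\{H\leqslant G\mid x\in H\}|$, the number of subgroups of $G$ containing $x$. *)

theory Defs
  imports "HOL-Algebra.Algebra"
begin

definition occ :: "('a, 'b) monoid_scheme \<Rightarrow> 'a \<Rightarrow> nat" where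
  "occ G x = card {H. subgroup H G \<and> x \<in> H}"

end

theory Submission
  imports Defs
begin

text \<open>Double counting of incident pairs. The factor \<open>occ G x\<close> counts the
  subgroups \<open>L\<close> containing \<open>x\<close>, so a sum over a finite set
  \<open>A\<close> weighted by it runs over the pairs \<open>(x, L)\<close> with \<open>x\<close> in
  \<open>A \<inter> L\<close>; grouping by \<open>L\<close> instead of by \<open>x\<close> trades
  the factor for an outer sum over subgroups. \<open>sum_mult_card_members\<close> is this exchange
  for any finite family of sets. Each of the two equalities removes one of the two factors of the
  square in this way.\<close>

lemma sum_mult_card_members:
  fixes f :: "'a \<Rightarrow> nat"
  assumes "finite A" and "finite S"
  shows "(\<Sum>x\<in>A. f x * card {L \<in> S. x \<in> L}) = (\<Sum>L\<in>S. \<Sum>x\<in>A \<inter> L. f x)"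
proof -
  have "(\<Sum>x\<in>A. f x * card {L \<in> S. x \<in> L}) = (\<Sum>x\<in>A. \<Sum>L\<in>{L \<in> S. x \<in> L}. f x)"
    by (simp add: mult.commute)
  also have "\<dots> = (\<Sum>L\<in>S. \<Sum>x\<in>{x \<in> A. x \<in> L}. f x)"
    using assms by (rule sum.swap_restrict)
  also have "\<dots> = (\<Sum>L\<in>S. \<Sum>x\<in>A \<inter> L. f x)"
    by (simp add: Int_def)
  finally show ?thesis .
qed

theorem theorem5p10:
  fixes G :: "('a, 'b) monoid_scheme" and \<mu> :: "'a \<Rightarrow> nat"
  assumes "group G" and "finite (carrier G)"
    and "\<And>x. x \<in> carrier G \<Longrightarrow> \<mu> x > 0"
    and "\<mu> \<one>\<^bsub>G\<^esub> = 1"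
  shows "(\<Sum>x\<in>carrier G. \<mu> x * (occ G x)\<^sup>2) =
           (\<Sum>H\<in>{H. subgroup H G}. \<Sum>x\<in>H. \<mu> x * occ G x) \<and>
         (\<Sum>H\<in>{H. subgroup H G}. \<Sum>x\<in>H. \<mu> x * occ G x) =
           (\<Sum>H\<in>{H. subgroup H G}. \<Sum>L\<in>{L. subgroup L G}. \<Sum>x\<in>H \<inter> L. \<mu> x)"
proof -
  let ?S = "{H. subgroup H G}"
  have sub: "H \<subseteq> carrier G" if "H \<in> ?S" for H
    using that by (simp add: subgroup.subset)
  then have fin: "finite ?S"
    by (intro finite_subset[OF _ finite_Pow_iff[THEN iffD2, OF assms(2)]]) auto
  \<comment> \<open>Both \<open>A\<close> and the weight \<open>f\<close> stay free because the two
    uses differ in them.\<close>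
  have count: "(\<Sum>x\<in>A. f x * occ G x) = (\<Sum>L\<in>?S. \<Sum>x\<in>A \<inter> L. f x)"
    if "finite A" for A and f :: "'a \<Rightarrow> nat"
    using sum_mult_card_members[OF that fin, of f] by (simp add: occ_def)
  have "(\<Sum>x\<in>carrier G. \<mu> x * (occ G x)\<^sup>2) = (\<Sum>x\<in>carrier G. (\<mu> x * occ G x) * occ G x)"
    by (simp add: power2_eq_square mult.assoc)
  \<comment> \<open>Only one factor of the square is expanded; the other is absorbed into the weight
    \<open>\<mu> x * occ G x\<close>.\<close>
  also have "\<dots> = (\<Sum>H\<in>?S. \<Sum>x\<in>carrier G \<inter> H. \<mu> x * occ G x)"
    using assms(2) by (rule count)
  also have "\<dots> = (\<Sum>H\<in>?S. \<Sum>x\<in>H. \<mu> x * occ G x)"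
    using sub by (intro sum.cong refl) blast+
  finally have first: "(\<Sum>x\<in>carrier G. \<mu> x * (occ G x)\<^sup>2) = (\<Sum>H\<in>?S. \<Sum>x\<in>H. \<mu> x * occ G x)" .
  \<comment> \<open>The remaining factor is expanded inside each fixed \<open>H\<close>:
    \<open>count\<close> with \<open>A = H\<close> and weight \<open>\<mu>\<close>, where
    \<open>H\<close> is finite as a subset of the carrier.\<close>
  have "(\<Sum>H\<in>?S. \<Sum>x\<in>H. \<mu> x * occ G x) = (\<Sum>H\<in>?S. \<Sum>L\<in>?S. \<Sum>x\<in>H \<inter> L. \<mu> x)"
    by (intro sum.cong refl count finite_subset[OF sub assms(2)])
  with first show ?thesis ..
qed

end
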